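(* Consider the closed-loop system $$\dot x = Ax + Bu + Qw,\qquad \dot u = -\epsilon\, \widetilde H^T \nabla \Phi(x,u),$$ with $x\in\mathbb{R}^n$, $u\in\mathbb{R}^p$, a constant disturbance $w\in\mathbb{R}^q$ and a gain $\epsilon>0$. Suppose that: (i) there is a symmetric positive definite $P$ with $A^TP+PA\preceq -I_n$; (ii) $\tilde\Phi^w(u):=\Phi(Hu+Rw,u)$ is differentiable in $u$ for all $u$ and $w$; (iii) there exists $\ell>0$ with $\|\widetilde H^T(\nabla\Phi(x,u)-\nabla\Phi(x',u))\|\le \ell\|x-x'\|$ for all $x,x'\in\mathbb{R}^n$, $u\in\mathbb{R}^p$; (iv) the sublevel sets of $\tilde\Phi^w$ are compact; (v) $\Phi$ is convex. If $\epsilon<\frac{1}{2\ell\|PH\|}$, then every trajectory of the closed-loop system converges to the set of global solutions of $$\min_{x,u}\ \Phi(x,u)\quad\text{subject to}\quad x=Hu+Rw.$$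
   Context: $A\in\mathbb{R}^{n\times n}$, $B\in\mathbb{R}^{n\times p}$, $Q\in\mathbb{R}^{n\times q}$ are real matrices; under (i) $A$ is invertible, and $H:=-A^{-1}B$, $R:=-A^{-1}Q$, $\widetilde H^T:=[\,H^T\ \ I_p\,]$. $\Phi:\mathbb{R}^n\times\mathbb{R}^p\to\mathbb{R}$ is a differentiable cost function with gradient $\nabla\Phi(x,u)\in\mathbb{R}^{n+p}$. Norms are Euclidean / induced 2-norms. The disturbance $w$ is fixed. *)

theory Defs
  imports "HOL-Analysis.Analysis"
begin

text \<open>H = -A^{-1} B and R = -A^{-1} Q.\<close>
definition Hmat :: "real^'n^'n \<Rightarrow> real^'p^'n \<Rightarrow> real^'p^'n" where
  "Hmat A B = - (matrix_inv A ** B)"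

definition Rmat :: "real^'n^'n \<Rightarrow> real^'q^'n \<Rightarrow> real^'q^'n" where
  "Rmat A Q = - (matrix_inv A ** Q)"

text \<open>Htilde^T applied to a gradient (g_x, g_u) in R^{n+p}: H^T g_x + g_u.\<close>
definition HtildeT :: "real^'p^'n \<Rightarrow> real^'n \<Rightarrow> real^'p \<Rightarrow> real^'p" where
  "HtildeT H gx gu = transpose H *v gx + gu"

text \<open>Set of global solutions of min Phi(x,u) s.t. x = H u + R w.\<close>
definition global_solutions ::
  "(real^'n \<Rightarrow> real^'p \<Rightarrow> real) \<Rightarrow> real^'p^'n \<Rightarrow> real^'q^'n \<Rightarrow> real^'q \<Rightarrow> ((real^'n) \<times> (real^'p)) set" where
  "global_solutions \<Phi> H R w =
     {(x, u). x = H *v u + R *v w \<and>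
        (\<forall>x' u'. x' = H *v u' + R *v w \<longrightarrow> \<Phi> x u \<le> \<Phi> x' u')}"

end

theory Submission
  imports Defs
begin

text \<open>
  Put z = x - (H u + R w), the deviation from the steady-state manifold of the plant, and
  y = H~^T \<nabla>\<Phi>(x, u), so that u' = -\<epsilon> y and z' = A z + \<epsilon> H y. On the manifold, y is the
  gradient of the convex reduced cost \<Phi>~(u) = \<Phi>(H u + R w, u); off it, the two differ by at
  most L |z|. Hence V = \<Phi>~(u) + \<alpha> z^T P z satisfies
  V' \<le> -\<epsilon> |y|^2 + \<epsilon> (L + 2 \<alpha> |P H|) |y| |z| - \<alpha> |z|^2, and the small-gain condition
  2 \<epsilon> L |P H| < 1 is exactly what admits a weight \<alpha> making this at most -\<delta> (|y|^2 + |z|^2).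
  Along the trajectory u stays in a compact sublevel set of \<Phi>~, where convexity bounds
  V - min \<Phi>~ by a multiple of |(y, z)| + |(y, z)|^2; so V cannot stay above min \<Phi>~ and
  decreases to it. Then z \<longrightarrow> 0 and \<Phi>~(u) \<longrightarrow> min \<Phi>~, and compactness of the sublevel set
  forces u towards the minimisers of \<Phi>~, hence (x, u) towards the global solutions.
\<close>

section \<open>Elementary inequalities\<close>

lemma quadratic_form_margin:
  fixes p q b :: real
  assumes "0 < p" "0 < q" "b\<^sup>2 < 4 * p * q"
  obtains \<delta> where "0 < \<delta>" "\<And>a c. b * a * c \<le> (p - \<delta>) * a\<^sup>2 + (q - \<delta>) * c\<^sup>2"
proof
  define \<delta> where "\<delta> = (4 * p * q - b\<^sup>2) / (4 * (p + q))"
  show "0 < \<delta>" using assms by (simp add: \<delta>_def)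
  have \<delta>_eq: "\<delta> * (4 * (p + q)) = 4 * p * q - b\<^sup>2" using assms by (simp add: \<delta>_def)
  have "\<delta> * (4 * (p + q)) < p * (4 * (p + q))"
  proof -
    have "p * (4 * (p + q)) - \<delta> * (4 * (p + q)) = 4 * (p * p) + b\<^sup>2"
      unfolding \<delta>_eq by (simp add: algebra_simps)
    moreover have "0 < 4 * (p * p) + b\<^sup>2" using assms by (simp add: add_pos_nonneg)
    ultimately show ?thesis by linarith
  qed
  then have p\<delta>: "0 < p - \<delta>" using assms by (simp add: mult_less_cancel_right)
  have "b\<^sup>2 = 4 * p * q - \<delta> * (4 * (p + q))" unfolding \<delta>_eq by simp
  also have "\<dots> \<le> 4 * (p - \<delta>) * (q - \<delta>)" by (simp add: algebra_simps)
  finally have disc: "b\<^sup>2 \<le> 4 * (p - \<delta>) * (q - \<delta>)" .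
  fix a c :: real
  have "4 * (p - \<delta>) * ((p - \<delta>) * a\<^sup>2 - b * a * c + (q - \<delta>) * c\<^sup>2)
      = (2 * (p - \<delta>) * a - b * c)\<^sup>2 + (4 * (p - \<delta>) * (q - \<delta>) - b\<^sup>2) * c\<^sup>2"
    by (simp add: algebra_simps power2_eq_square)
  also have "\<dots> \<ge> 0" using disc by simp
  finally show "b * a * c \<le> (p - \<delta>) * a\<^sup>2 + (q - \<delta>) * c\<^sup>2"
    using p\<delta> by (simp add: zero_le_mult_iff)
qed

lemma small_gain_weight_exists:
  fixes \<epsilon> L k :: real
  assumes "0 < \<epsilon>" "0 < L" "0 \<le> k" "2 * \<epsilon> * L * k < 1"
  obtains \<alpha> where "0 < \<alpha>" "(\<epsilon> * (L + 2 * \<alpha> * k))\<^sup>2 < 4 * \<epsilon> * \<alpha>"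
proof (cases "k = 0")
  case True
  show ?thesis by (rule that[of "\<epsilon> * L\<^sup>2"]) (use True assms in \<open>auto simp: power2_eq_square\<close>)
next
  case False
  then have "0 < k" using assms by simp
  have "(\<epsilon> * (L + 2 * (L / (2 * k)) * k))\<^sup>2 = 2 * \<epsilon> * L * k * (4 * \<epsilon> * (L / (2 * k)))"
    using \<open>0 < k\<close> by (simp add: field_simps power2_eq_square)
  also have "\<dots> < 4 * \<epsilon> * (L / (2 * k))"
    using mult_strict_right_mono[OF assms(4), of "4 * \<epsilon> * (L / (2 * k))"] assms \<open>0 < k\<close> by simp
  finally show ?thesis by (rule that[rotated]) (use assms \<open>0 < k\<close> in auto)
qed

lemma linear_quadratic_bound_imp_lower_bound:
  fixes \<eta> C :: real
  assumes "0 < \<eta>"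
  obtains r where "0 < r" "\<And>s. 0 \<le> s \<Longrightarrow> \<eta> \<le> C * (s + s\<^sup>2) \<Longrightarrow> r \<le> s"
proof (cases "0 < C")
  case True
  show ?thesis
  proof
    show "0 < min 1 (\<eta> / (2 * C))" using assms True by simp
    fix s :: real assume "0 \<le> s" and bound: "\<eta> \<le> C * (s + s\<^sup>2)"
    show "min 1 (\<eta> / (2 * C)) \<le> s"
    proof (rule ccontr)
      assume "\<not> ?thesis"
      then have "s < 1" "s < \<eta> / (2 * C)" by (auto simp: min_le_iff_disj not_le)
      then have "2 * C * s < \<eta>"
        using pos_less_divide_eq[of "2 * C" s \<eta>] True by (simp add: algebra_simps)
      moreover have "s\<^sup>2 \<le> s" using \<open>0 \<le> s\<close> \<open>s < 1\<close> using mult_left_le[of s s] by (simp add: power2_eq_square)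
      moreover have "C * (s + s\<^sup>2) \<le> C * (2 * s)"
        using True \<open>s\<^sup>2 \<le> s\<close> by (intro mult_left_mono) auto
      ultimately have "C * (s + s\<^sup>2) < \<eta>" by linarith
      with bound show False by simp
    qed
  qed
next
  case False
  then have "C * (s + s\<^sup>2) \<le> 0" if "0 \<le> s" for s :: real
    using that by (simp add: mult_nonpos_nonneg)
  with assms show ?thesis by (intro that[of 1]) fastforce+
qed

section \<open>Strict Lyapunov functions on the half-line\<close>

lemma DERIV_nonpos_imp_decreasing_on_nonneg:
  fixes f f' :: "real \<Rightarrow> real"
  assumes deriv: "\<And>t. 0 \<le> t \<Longrightarrow> (f has_real_derivative f' t) (at t within {0..})"
    and nonpos: "\<And>t. 0 \<le> t \<Longrightarrow> f' t \<le> 0"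
    and "0 \<le> a" "a \<le> b"
  shows "f b \<le> f a"
proof (rule DERIV_nonpos_imp_decreasing_open[OF \<open>a \<le> b\<close>])
  fix t assume t: "a < t" "t < b"
  have "at t within {0..} = at t"
    by (rule at_within_open_subset[of _ "{0<..}"]) (use t \<open>0 \<le> a\<close> in auto)
  then show "\<exists>y. (f has_real_derivative y) (at t) \<and> y \<le> 0"
    using deriv[of t] nonpos[of t] t \<open>0 \<le> a\<close> by auto
next
  have "continuous_on {0..} f"
    unfolding continuous_on_eq_continuous_within using deriv DERIV_continuous by fastforce
  then show "continuous_on {a..b} f"
    by (rule continuous_on_subset) (use \<open>0 \<le> a\<close> in auto)
qed

lemma DERIV_le_neg_const_imp_linear_decrease:
  fixes f f' :: "real \<Rightarrow> real"
  assumes deriv: "\<And>t. 0 \<le> t \<Longrightarrow> (f has_real_derivative f' t) (at t within {0..})"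
    and rate: "\<And>t. 0 \<le> t \<Longrightarrow> f' t \<le> - c" and "0 \<le> T"
  shows "f T + c * T \<le> f 0"
proof -
  have "(\<lambda>t. f t + c * t) T \<le> (\<lambda>t. f t + c * t) 0"
  proof (rule DERIV_nonpos_imp_decreasing_on_nonneg[of "\<lambda>t. f t + c * t" "\<lambda>t. f' t + c" 0 T])
    fix t :: real assume "0 \<le> t"
    show "((\<lambda>t. f t + c * t) has_real_derivative f' t + c) (at t within {0..})"
      using deriv[OF \<open>0 \<le> t\<close>] by (auto intro!: derivative_eq_intros)
    show "f' t + c \<le> 0" using rate[OF \<open>0 \<le> t\<close>] by simp
  qed (use \<open>0 \<le> T\<close> in auto)
  then show ?thesis by simp
qed

lemma lyapunov_decay_reaches_below:
  fixes V V' s :: "real \<Rightarrow> real"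
  assumes deriv: "\<And>t. 0 \<le> t \<Longrightarrow> (V has_real_derivative V' t) (at t within {0..})"
    and decay: "\<And>t. 0 \<le> t \<Longrightarrow> V' t \<le> - \<gamma> * (s t)\<^sup>2" and "0 < \<gamma>"
    and lower: "\<And>t. 0 \<le> t \<Longrightarrow> m \<le> V t"
    and gap: "\<And>t. 0 \<le> t \<Longrightarrow> V t - m \<le> C * (s t + (s t)\<^sup>2)"
    and s_nonneg: "\<And>t. 0 \<le> s t"
    and "0 < \<eta>"
  shows "\<exists>T\<ge>0. V T < m + \<eta>"
proof (rule ccontr)
  assume "\<not> ?thesis"
  then have far: "\<eta> \<le> V t - m" if "0 \<le> t" for t using that by force
  obtain r where "0 < r" and r: "\<And>s. 0 \<le> s \<Longrightarrow> \<eta> \<le> C * (s + s\<^sup>2) \<Longrightarrow> r \<le> s"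
    using linear_quadratic_bound_imp_lower_bound[OF \<open>0 < \<eta>\<close>] by blast
  have rate: "V' t \<le> - (\<gamma> * r\<^sup>2)" if "0 \<le> t" for t
  proof -
    have "r \<le> s t" using far[OF that] gap[OF that] s_nonneg by (intro r) auto
    then have "\<gamma> * r\<^sup>2 \<le> \<gamma> * (s t)\<^sup>2"
      using \<open>0 < r\<close> \<open>0 < \<gamma>\<close> by (intro mult_left_mono power_mono) auto
    then show ?thesis using decay[OF that] by simp
  qed
  \<comment> \<open>a uniform decay rate would drive \<open>V\<close> below its lower bound \<open>m\<close>\<close>
  define T where "T = (V 0 - m) / (\<gamma> * r\<^sup>2)"
  have "0 \<le> T" using lower[of 0] \<open>0 < \<gamma>\<close> by (simp add: T_def)
  have "V T + \<gamma> * r\<^sup>2 * T \<le> V 0"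
    by (rule DERIV_le_neg_const_imp_linear_decrease[OF deriv rate \<open>0 \<le> T\<close>])
  then have "V T \<le> m" using \<open>0 < r\<close> \<open>0 < \<gamma>\<close> by (simp add: T_def)
  then show False using far[OF \<open>0 \<le> T\<close>] \<open>0 < \<eta>\<close> by simp
qed

lemma lyapunov_decay_tendsto:
  fixes V V' s :: "real \<Rightarrow> real"
  assumes deriv: "\<And>t. 0 \<le> t \<Longrightarrow> (V has_real_derivative V' t) (at t within {0..})"
    and decay: "\<And>t. 0 \<le> t \<Longrightarrow> V' t \<le> - \<gamma> * (s t)\<^sup>2" and "0 < \<gamma>"
    and lower: "\<And>t. 0 \<le> t \<Longrightarrow> m \<le> V t"
    and gap: "\<And>t. 0 \<le> t \<Longrightarrow> V t - m \<le> C * (s t + (s t)\<^sup>2)"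
    and s_nonneg: "\<And>t. 0 \<le> s t"
  shows "(V \<longlongrightarrow> m) at_top"
proof (rule order_tendstoI)
  fix a assume "a < m"
  show "\<forall>\<^sub>F t in at_top. a < V t"
    using eventually_ge_at_top[of 0] by eventually_elim (use lower \<open>a < m\<close> in force)
next
  fix a assume "m < a"
  then obtain T where "0 \<le> T" "V T < a"
    using lyapunov_decay_reaches_below[OF assms, of "a - m"] by auto
  have decreasing: "V t \<le> V T" if "T \<le> t" for t
  proof (rule DERIV_nonpos_imp_decreasing_on_nonneg[OF deriv _ \<open>0 \<le> T\<close> that])
    fix t :: real assume "0 \<le> t"
    have "0 \<le> \<gamma> * (s t)\<^sup>2" using \<open>0 < \<gamma>\<close> by simp
    then show "V' t \<le> 0" using decay[OF \<open>0 \<le> t\<close>] by linarith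
  qed
  show "\<forall>\<^sub>F t in at_top. V t < a"
    using eventually_ge_at_top[of T] by eventually_elim (use decreasing \<open>V T < a\<close> in force)
qed

section \<open>Matrices and quadratic forms\<close>

lemma quadratic_form_pos_def_lower_bound:
  fixes P :: "real^'n^'n"
  assumes pd: "\<And>v. v \<noteq> 0 \<Longrightarrow> 0 < v \<bullet> (P *v v)"
  obtains \<mu> where "0 < \<mu>" "\<And>v. \<mu> * (norm v)\<^sup>2 \<le> v \<bullet> (P *v v)"
proof -
  have cont: "continuous_on (sphere 0 1) (\<lambda>v::real^'n. v \<bullet> (P *v v))"
    by (intro continuous_intros linear_continuous_on matrix_vector_mul_bounded_linear)
  obtain v0 where v0: "v0 \<in> sphere 0 1" and min: "\<And>v. v \<in> sphere 0 1 \<Longrightarrow> v0 \<bullet> (P *v v0) \<le> v \<bullet> (P *v v)"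
    using continuous_attains_inf[OF compact_sphere _ cont] by (auto simp: sphere_eq_empty)
  show ?thesis
  proof
    have "v0 \<noteq> 0" using v0 by auto
    then show "0 < v0 \<bullet> (P *v v0)" by (rule pd)
    fix v :: "real^'n"
    show "(v0 \<bullet> (P *v v0)) * (norm v)\<^sup>2 \<le> v \<bullet> (P *v v)"
    proof (cases "v = 0")
      case False
      have "v0 \<bullet> (P *v v0) \<le> (v /\<^sub>R norm v) \<bullet> (P *v (v /\<^sub>R norm v))"
        using False by (intro min) simp
      also have "\<dots> = (v \<bullet> (P *v v)) / (norm v)\<^sup>2"
        by (simp add: matrix_vector_mult_scaleR power2_eq_square divide_inverse)
      finally show ?thesis using False by (simp add: pos_le_divide_eq)
    qed simp
  qed
qed

lemma quadratic_form_le_onorm: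
  fixes P :: "real^'n^'n"
  shows "v \<bullet> (P *v v) \<le> onorm ((*v) P) * (norm v)\<^sup>2"
proof -
  have "v \<bullet> (P *v v) \<le> norm v * norm (P *v v)"
    by (rule order_trans[OF abs_ge_self Cauchy_Schwarz_ineq2])
  also have "\<dots> \<le> norm v * (onorm ((*v) P) * norm v)"
    by (intro mult_left_mono onorm matrix_vector_mul_bounded_linear) auto
  finally show ?thesis by (simp add: power2_eq_square algebra_simps)
qed

lemma symmetric_matrix_inner_commute:
  fixes P :: "real^'n^'n"
  assumes "transpose P = P"
  shows "(P *v a) \<bullet> b = a \<bullet> (P *v b)"
  using dot_lmul_matrix[of a P b] transpose_matrix_vector[of P a] assms by simp

lemma quadratic_form_lyapunov_matrix:
  fixes A P :: "real^'n^'n"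
  assumes "transpose P = P"
  shows "v \<bullet> ((transpose A ** P + P ** A) *v v) = 2 * (v \<bullet> (P *v (A *v v)))"
proof -
  have "v \<bullet> ((transpose A ** P) *v v) = (P *v v) \<bullet> (A *v v)"
    by (subst inner_commute) (simp add: dot_lmul_matrix flip: matrix_vector_mul_assoc)
  also have "\<dots> = v \<bullet> (P *v (A *v v))"
    by (rule symmetric_matrix_inner_commute[OF assms])
  finally show ?thesis
    by (simp add: matrix_vector_mult_add_rdistrib inner_add_right flip: matrix_vector_mul_assoc)
qed

lemma has_real_derivative_quadratic_form:
  fixes P :: "real^'n^'n"
  assumes "transpose P = P" and f: "(f has_vector_derivative f') (at t within S)"
  shows "((\<lambda>t. f t \<bullet> (P *v f t)) has_real_derivative 2 * (f t \<bullet> (P *v f'))) (at t within S)"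
proof -
  have "((\<lambda>t. P *v f t) has_vector_derivative P *v f') (at t within S)"
    by (rule bounded_linear.has_vector_derivative[OF matrix_vector_mul_bounded_linear f])
  from bounded_bilinear.has_vector_derivative[OF bounded_bilinear_inner f this]
  show ?thesis
    using symmetric_matrix_inner_commute[OF assms(1), of f' "f t"]
    by (simp add: has_real_derivative_iff_has_vector_derivative inner_commute)
qed

lemma lyapunov_imp_invertible:
  fixes A P :: "real^'n^'n"
  assumes lyap: "\<And>v. v \<bullet> ((transpose A ** P + P ** A) *v v) \<le> - (v \<bullet> v)"
  shows "invertible A"
proof -
  have "v = 0" if "A *v v = 0" for v
  proof -
    have "v \<bullet> ((transpose A ** P + P ** A) *v v) = 0"
      using that by (simp add: matrix_vector_mult_add_rdistrib inner_add_right dot_lmul_matrix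
          flip: matrix_vector_mul_assoc) (simp add: inner_commute[of v] dot_lmul_matrix)
    then have "v \<bullet> v \<le> 0" using lyap[of v] by simp
    then show ?thesis using inner_ge_zero[of v] by simp
  qed
  then have "inj ((*v) A)"
    by (intro injI) (metis matrix_vector_mult_diff_distrib right_minus_eq)
  then show ?thesis
    using matrix_left_invertible_injective invertible_left_inverse by blast
qed

lemma invertible_matrix_inv_right:
  fixes A :: "real^'n^'n"
  assumes "invertible A"
  shows "A ** matrix_inv A = mat 1"
  using assms unfolding invertible_def matrix_inv_def by (rule someI2_ex) auto

lemma matrix_vector_mult_uminus_left: "(- M) *v v = - (M *v v)"
  for M :: "real^'m^'n"
  using matrix_vector_mult_diff_rdistrib[of 0 M v] by simp

section \<open>Convexity and distance to the minimisers\<close>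

lemma convex_on_has_derivative_above_tangent:
  fixes F :: "'a::real_normed_vector \<Rightarrow> real"
  assumes cvx: "convex_on UNIV F" and deriv: "(F has_derivative F') (at p)"
  shows "F p + F' (q - p) \<le> F q"
proof -
  define g where "g = (\<lambda>s::real. F (p + s *\<^sub>R (q - p)))"
  have "convex_on UNIV g"
  proof (rule convex_onI)
    fix t s1 s2 :: real assume "0 < t" "t < 1"
    have "p + ((1 - t) * s1 + t * s2) *\<^sub>R (q - p)
        = (1 - t) *\<^sub>R (p + s1 *\<^sub>R (q - p)) + t *\<^sub>R (p + s2 *\<^sub>R (q - p))"
      by (simp add: algebra_simps)
    then show "g ((1 - t) *\<^sub>R s1 + t *\<^sub>R s2) \<le> (1 - t) * g s1 + t * g s2"
      using convex_onD[OF cvx, of t] \<open>0 < t\<close> \<open>t < 1\<close> by (simp add: g_def)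
  qed simp
  moreover have "(g has_field_derivative F' (q - p)) (at 0)"
  proof -
    have "((\<lambda>s::real. p + s *\<^sub>R (q - p)) has_vector_derivative (q - p)) (at 0)"
      by (auto intro!: derivative_eq_intros)
    then have "((F \<circ> (\<lambda>s. p + s *\<^sub>R (q - p))) has_vector_derivative F' (q - p)) (at 0)"
      by (rule vector_derivative_diff_chain_within) (simp add: deriv has_derivative_at_withinI)
    then show ?thesis
      by (simp add: g_def o_def has_real_derivative_iff_has_vector_derivative)
  qed
  ultimately have "F' (q - p) * (1 - 0) \<le> g 1 - g 0"
    by (intro convex_on_imp_above_tangent[where A = UNIV]) auto
  then show ?thesis by (simp add: g_def)
qed

lemma tendsto_infdist_argmin:
  fixes f :: "'a::metric_space \<Rightarrow> real" and g :: "'b \<Rightarrow> 'a"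
  assumes "compact K" and cont: "continuous_on K f"
    and in_K: "\<forall>\<^sub>F t in F. g t \<in> K" and lim: "((\<lambda>t. f (g t)) \<longlongrightarrow> m) F"
    and min: "\<And>v. v \<in> K \<Longrightarrow> m \<le> f v" and argmin: "\<And>v. v \<in> K \<Longrightarrow> f v = m \<Longrightarrow> v \<in> M"
  shows "((\<lambda>t. infdist (g t) M) \<longlongrightarrow> 0) F"
proof (rule tendstoI)
  fix \<rho> :: real assume "0 < \<rho>"
  define K\<rho> where "K\<rho> = K \<inter> {v. \<rho> \<le> infdist v M}"
  have "compact K\<rho>"
    unfolding K\<rho>_def
    by (intro compact_Int_closed \<open>compact K\<close> closed_Collect_le continuous_intros)
  \<comment> \<open>on the compact set of points at distance \<open>\<ge> \<rho>\<close> from the minimisers, \<open>f\<close> stays away from \<open>m\<close>\<close>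
  obtain c where "m < c" and c: "\<And>v. v \<in> K\<rho> \<Longrightarrow> c \<le> f v"
  proof (cases "K\<rho> = {}")
    case False
    then obtain v0 where v0: "v0 \<in> K\<rho>" and v0_min: "\<And>v. v \<in> K\<rho> \<Longrightarrow> f v0 \<le> f v"
      using continuous_attains_inf[OF \<open>compact K\<rho>\<close> False continuous_on_subset[OF cont]]
      by (auto simp: K\<rho>_def)
    have "f v0 \<noteq> m"
      using v0 argmin[of v0] \<open>0 < \<rho>\<close> by (auto simp: K\<rho>_def)
    with v0 min[of v0] show ?thesis by (intro that[OF _ v0_min]) (auto simp: K\<rho>_def)
  qed (use that[of "m + 1"] in auto)
  have "\<forall>\<^sub>F t in F. f (g t) < c" using lim \<open>m < c\<close> by (rule order_tendstoD)
  with in_K show "\<forall>\<^sub>F t in F. dist (infdist (g t) M) 0 < \<rho>"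
    by eventually_elim (use c in \<open>force simp: K\<rho>_def infdist_nonneg\<close>)
qed

lemma infdist_graph_le:
  fixes f :: "'a::euclidean_space \<Rightarrow> 'b::real_normed_vector"
  assumes "bounded_linear f" "closed M" "M \<noteq> {}"
  shows "infdist (y, v) ((\<lambda>m. (f m + c, m)) ` M) \<le> norm (y - (f v + c)) + (onorm f + 1) * infdist v M"
proof -
  obtain m where "m \<in> M" and m: "infdist v M = dist v m"
    using infdist_attains_inf[OF assms(2,3)] by blast
  have "infdist (y, v) ((\<lambda>m. (f m + c, m)) ` M) \<le> dist (y, v) (f m + c, m)"
    using \<open>m \<in> M\<close> by (intro infdist_le) auto
  also have "\<dots> \<le> norm (y - (f m + c)) + norm (v - m)"
    by (simp add: dist_norm norm_Pair_le)
  also have "y - (f m + c) = (y - (f v + c)) + f (v - m)"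
    using linear_diff[OF bounded_linear.linear[OF assms(1)]] by (simp add: algebra_simps)
  also have "norm \<dots> \<le> norm (y - (f v + c)) + onorm f * norm (v - m)"
    using norm_triangle_ineq[of "y - (f v + c)" "f (v - m)"] onorm[OF assms(1), of "v - m"] by linarith
  finally show ?thesis by (simp add: m dist_norm algebra_simps)
qed

section \<open>The closed-loop system\<close>

locale closed_loop =
  fixes A :: "real^'n^'n" and B :: "real^'p^'n" and Q :: "real^'q^'n" and P :: "real^'n^'n"
    and \<Phi> :: "real^'n \<Rightarrow> real^'p \<Rightarrow> real"
    and gx :: "real^'n \<Rightarrow> real^'p \<Rightarrow> real^'n" and gu :: "real^'n \<Rightarrow> real^'p \<Rightarrow> real^'p"
    and w :: "real^'q" and \<epsilon> :: real and L :: real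
    and x :: "real \<Rightarrow> real^'n" and u :: "real \<Rightarrow> real^'p"
  assumes grad: "\<And>x0 u0. ((\<lambda>(x, u). \<Phi> x u) has_derivative
                   (\<lambda>(dx, du). gx x0 u0 \<bullet> dx + gu x0 u0 \<bullet> du)) (at (x0, u0))"
    and eps_pos: "\<epsilon> > 0"
    and P_sym: "transpose P = P"
    and P_pd: "\<And>v. v \<noteq> 0 \<Longrightarrow> v \<bullet> (P *v v) > 0"
    and lyap: "\<And>v. v \<bullet> ((transpose A ** P + P ** A) *v v) \<le> - (v \<bullet> v)"
    and l_pos: "L > 0"
    and lip: "\<And>x1 x2 u0. norm (HtildeT (Hmat A B) (gx x1 u0) (gu x1 u0)
                               - HtildeT (Hmat A B) (gx x2 u0) (gu x2 u0)) \<le> L * norm (x1 - x2)"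
    and sublevel: "\<And>c. compact {u. \<Phi> (Hmat A B *v u + Rmat A Q *v w) u \<le> c}"
    and cvx: "convex_on UNIV (\<lambda>(x, u). \<Phi> x u)"
    and eps_small: "2 * \<epsilon> * L * onorm (\<lambda>v. (P ** Hmat A B) *v v) < 1"
    and x_ode: "\<And>t. t \<ge> 0 \<Longrightarrow> (x has_vector_derivative (A *v x t + B *v u t + Q *v w)) (at t within {0..})"
    and u_ode: "\<And>t. t \<ge> 0 \<Longrightarrow> (u has_vector_derivative
                 (- \<epsilon> *\<^sub>R HtildeT (Hmat A B) (gx (x t) (u t)) (gu (x t) (u t)))) (at t within {0..})"
begin

abbreviation H where "H \<equiv> Hmat A B"
abbreviation R where "R \<equiv> Rmat A Q"

definition reduced_cost :: "real^'p \<Rightarrow> real" where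
  "reduced_cost v = \<Phi> (H *v v + R *v w) v"

definition reduced_grad :: "real^'p \<Rightarrow> real^'p" where
  "reduced_grad v = HtildeT H (gx (H *v v + R *v w) v) (gu (H *v v + R *v w) v)"

definition feedback :: "real \<Rightarrow> real^'p" where
  "feedback t = HtildeT H (gx (x t) (u t)) (gu (x t) (u t))"

definition steady_state_error :: "real \<Rightarrow> real^'n" where
  "steady_state_error t = x t - (H *v u t + R *v w)"

definition minimisers :: "(real^'p) set" where
  "minimisers = {v. \<forall>v'. reduced_cost v \<le> reduced_cost v'}"

definition lyapunov :: "real \<Rightarrow> real \<Rightarrow> real" where
  "lyapunov \<alpha> t = reduced_cost (u t) + \<alpha> * (steady_state_error t \<bullet> (P *v steady_state_error t))"

definition lyapunov_deriv :: "real \<Rightarrow> real \<Rightarrow> real" where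
  "lyapunov_deriv \<alpha> t = - \<epsilon> * (reduced_grad (u t) \<bullet> feedback t)
     + 2 * \<alpha> * (steady_state_error t \<bullet> (P *v (A *v steady_state_error t + \<epsilon> *\<^sub>R (H *v feedback t))))"

lemma drift_eq_A_steady_state_error: "A *v x t + B *v u t + Q *v w = A *v steady_state_error t"
proof -
  have "A ** matrix_inv A = mat 1"
    by (intro invertible_matrix_inv_right lyapunov_imp_invertible[OF lyap])
  then have "A *v (H *v v) = - (B *v v)" "A *v (R *v w') = - (Q *v w')" for v w'
    by (simp_all add: Hmat_def Rmat_def matrix_vector_mult_uminus_left vec.neg matrix_vector_mul_assoc
        matrix_mul_assoc)
  then show ?thesis
    by (simp add: steady_state_error_def matrix_vector_mult_diff_distrib matrix_vector_right_distrib)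
qed

lemma steady_state_error_has_derivative:
  assumes "0 \<le> t"
  shows "(steady_state_error has_vector_derivative A *v steady_state_error t + \<epsilon> *\<^sub>R (H *v feedback t))
           (at t within {0..})"
proof -
  have Hu: "((\<lambda>t. H *v u t) has_vector_derivative H *v (- \<epsilon> *\<^sub>R feedback t)) (at t within {0..})"
    using bounded_linear.has_vector_derivative[OF matrix_vector_mul_bounded_linear u_ode[OF assms]]
    by (simp add: feedback_def)
  have "(steady_state_error has_vector_derivative
          (A *v x t + B *v u t + Q *v w) - (H *v (- \<epsilon> *\<^sub>R feedback t) + 0)) (at t within {0..})"
    unfolding steady_state_error_def[abs_def] by (intro derivative_intros x_ode[OF assms] Hu)
  then show ?thesis
    by (simp add: steady_state_error_def[abs_def] drift_eq_A_steady_state_error matrix_vector_mult_scaleR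
        vec.neg)
qed

lemma reduced_cost_has_derivative: "(reduced_cost has_derivative (\<lambda>h. reduced_grad v \<bullet> h)) (at v)"
proof -
  have "((\<lambda>v. (H *v v + R *v w, v)) has_derivative (\<lambda>h. (H *v h, h))) (at v)"
    by (auto intro!: derivative_eq_intros bounded_linear.has_derivative[OF matrix_vector_mul_bounded_linear])
  from diff_chain_at[OF this grad]
  show ?thesis
    by (simp add: o_def reduced_cost_def[abs_def] reduced_grad_def HtildeT_def inner_add_left
        dot_lmul_matrix)
qed

lemma continuous_on_reduced_cost: "continuous_on UNIV reduced_cost"
  by (intro continuous_at_imp_continuous_on ballI has_derivative_continuous[OF reduced_cost_has_derivative])

lemma convex_on_reduced_cost: "convex_on UNIV reduced_cost"
proof (rule convex_onI)
  fix t :: real and a b :: "real^'p"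
  have "(H *v ((1 - t) *\<^sub>R a + t *\<^sub>R b) + R *v w, (1 - t) *\<^sub>R a + t *\<^sub>R b)
      = (1 - t) *\<^sub>R (H *v a + R *v w, a) + t *\<^sub>R (H *v b + R *v w, b)"
    by (simp add: matrix_vector_right_distrib matrix_vector_mult_scaleR algebra_simps)
  moreover assume "0 < t" "t < 1"
  ultimately show "reduced_cost ((1 - t) *\<^sub>R a + t *\<^sub>R b) \<le> (1 - t) * reduced_cost a + t * reduced_cost b"
    using convex_onD[OF cvx, of t "(H *v a + R *v w, a)" "(H *v b + R *v w, b)"]
    by (simp add: reduced_cost_def)
qed simp

lemma compact_reduced_cost_sublevel: "compact {v. reduced_cost v \<le> c}"
  using sublevel[of c] by (simp add: reduced_cost_def)

lemma reduced_cost_attains_min: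
  obtains v0 where "v0 \<in> minimisers"
proof -
  define K where "K = {v. reduced_cost v \<le> reduced_cost 0}"
  have "compact K" using compact_reduced_cost_sublevel by (simp add: K_def)
  moreover have "K \<noteq> {}" by (auto simp: K_def)
  moreover have "continuous_on K reduced_cost"
    using continuous_on_subset[OF continuous_on_reduced_cost] by simp
  ultimately obtain v0 where min: "\<And>v. v \<in> K \<Longrightarrow> reduced_cost v0 \<le> reduced_cost v"
    by (metis continuous_attains_inf)
  have "reduced_cost v0 \<le> reduced_cost v" for v
    using min[of v] min[of 0] by (cases "v \<in> K") (auto simp: K_def)
  then show ?thesis by (intro that[of v0]) (simp add: minimisers_def)
qed

lemma closed_minimisers: "closed minimisers"
  unfolding minimisers_def
  by (intro closed_Collect_all closed_Collect_le continuous_on_reduced_cost continuous_on_const)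

lemma global_solutions_eq_minimisers:
  "global_solutions \<Phi> H R w = (\<lambda>v. (H *v v + R *v w, v)) ` minimisers"
  unfolding global_solutions_def minimisers_def reduced_cost_def by auto

lemma infdist_global_solutions_le:
  "infdist (x t, u t) (global_solutions \<Phi> H R w)
     \<le> norm (steady_state_error t) + (onorm ((*v) H) + 1) * infdist (u t) minimisers"
proof -
  obtain v0 where "v0 \<in> minimisers" by (rule reduced_cost_attains_min)
  then show ?thesis
    using infdist_graph_le[OF matrix_vector_mul_bounded_linear closed_minimisers,
        where y = "x t" and v = "u t" and c = "R *v w"]
    by (auto simp: global_solutions_eq_minimisers steady_state_error_def)
qed

lemma norm_reduced_grad_minus_feedback_le:
  "norm (reduced_grad (u t) - feedback t) \<le> L * norm (steady_state_error t)"
  using lip[of "H *v u t + R *v w" "u t" "x t"]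
  by (simp add: reduced_grad_def feedback_def steady_state_error_def norm_minus_commute)

lemma reduced_cost_gap:
  assumes "v0 \<in> minimisers"
  shows "reduced_cost (u t) - reduced_cost v0
           \<le> (norm (feedback t) + L * norm (steady_state_error t)) * norm (u t - v0)"
proof -
  have "reduced_cost (u t) - reduced_cost v0 \<le> reduced_grad (u t) \<bullet> (u t - v0)"
    using convex_on_has_derivative_above_tangent[OF convex_on_reduced_cost reduced_cost_has_derivative,
        of "u t" v0]
    by (simp add: inner_diff_right)
  also have "\<dots> \<le> norm (reduced_grad (u t)) * norm (u t - v0)"
    by (rule order_trans[OF abs_ge_self Cauchy_Schwarz_ineq2])
  also have "\<dots> \<le> (norm (feedback t) + L * norm (steady_state_error t)) * norm (u t - v0)"
    using norm_triangle_ineq[of "feedback t" "reduced_grad (u t) - feedback t"]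
      norm_reduced_grad_minus_feedback_le[of t] by (intro mult_right_mono) auto
  finally show ?thesis .
qed

lemma quadratic_form_P_nonneg: "0 \<le> v \<bullet> (P *v v)"
  using P_pd[of v] by (cases "v = 0") auto

lemma lyapunov_has_derivative:
  assumes "0 \<le> t"
  shows "(lyapunov \<alpha> has_real_derivative lyapunov_deriv \<alpha> t) (at t within {0..})"
proof -
  have "((\<lambda>t. reduced_cost (u t)) has_real_derivative reduced_grad (u t) \<bullet> (- \<epsilon> *\<^sub>R feedback t))
          (at t within {0..})"
    using vector_derivative_diff_chain_within[OF u_ode[OF assms]
        has_derivative_at_withinI[OF reduced_cost_has_derivative]]
    by (simp add: o_def feedback_def has_real_derivative_iff_has_vector_derivative)
  moreover note has_real_derivative_quadratic_form[OF P_sym steady_state_error_has_derivative[OF assms]]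
  ultimately show ?thesis
    unfolding lyapunov_def[abs_def] lyapunov_deriv_def
    by (auto intro!: derivative_eq_intros)
qed

lemma lyapunov_deriv_le:
  assumes "0 \<le> \<alpha>"
  defines "k \<equiv> onorm (\<lambda>v. (P ** H) *v v)"
  shows "lyapunov_deriv \<alpha> t
    \<le> - \<epsilon> * (norm (feedback t))\<^sup>2 + \<epsilon> * (L + 2 * \<alpha> * k) * norm (feedback t) * norm (steady_state_error t)
       - \<alpha> * (norm (steady_state_error t))\<^sup>2"
proof -
  define y where "y = feedback t"
  define z where "z = steady_state_error t"
  define G where "G = reduced_grad (u t)"
  have "- ((G - y) \<bullet> y) \<le> L * norm z * norm y"
    using Cauchy_Schwarz_ineq2[of "G - y" y] norm_reduced_grad_minus_feedback_le[of t]
      mult_right_mono[of "norm (G - y)" "L * norm z" "norm y"]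
    by (simp add: G_def y_def z_def)
  then have "\<epsilon> * (- ((G - y) \<bullet> y)) \<le> \<epsilon> * (L * norm z * norm y)"
    using eps_pos by (intro mult_left_mono) auto
  then have cost: "- \<epsilon> * (G \<bullet> y) \<le> - \<epsilon> * (norm y)\<^sup>2 + \<epsilon> * L * norm z * norm y"
    by (simp add: inner_diff_left power2_norm_eq_inner algebra_simps)
  have "z \<bullet> ((P ** H) *v y) \<le> norm z * norm ((P ** H) *v y)"
    by (rule order_trans[OF abs_ge_self Cauchy_Schwarz_ineq2])
  also have "\<dots> \<le> norm z * (k * norm y)"
    unfolding k_def by (intro mult_left_mono onorm matrix_vector_mul_bounded_linear) auto
  finally have "\<epsilon> * (z \<bullet> ((P ** H) *v y)) \<le> \<epsilon> * (k * norm z * norm y)"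
    using eps_pos by (intro mult_left_mono) (auto simp: algebra_simps)
  moreover have "2 * (z \<bullet> (P *v (A *v z))) \<le> - (norm z)\<^sup>2"
    using lyap[of z] quadratic_form_lyapunov_matrix[OF P_sym] by (simp add: power2_norm_eq_inner)
  moreover have "z \<bullet> (P *v (A *v z + \<epsilon> *\<^sub>R (H *v y)))
      = z \<bullet> (P *v (A *v z)) + \<epsilon> * (z \<bullet> ((P ** H) *v y))"
    by (simp add: matrix_vector_right_distrib matrix_vector_mult_scaleR inner_add_right
        matrix_vector_mul_assoc)
  ultimately have "2 * (z \<bullet> (P *v (A *v z + \<epsilon> *\<^sub>R (H *v y))))
      \<le> - (norm z)\<^sup>2 + 2 * (\<epsilon> * (k * norm z * norm y))"
    by linarith
  from mult_left_mono[OF this assms(1)] cost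
  show ?thesis
    unfolding lyapunov_deriv_def by (simp add: G_def y_def z_def algebra_simps)
qed

lemma lyapunov_decay:
  obtains \<alpha> \<delta> where "0 < \<alpha>" "0 < \<delta>"
    "\<And>t. lyapunov_deriv \<alpha> t \<le> - \<delta> * (norm (feedback t, steady_state_error t))\<^sup>2"
proof -
  define k where "k = onorm (\<lambda>v. (P ** H) *v v)"
  have "0 \<le> k" unfolding k_def by (intro onorm_pos_le matrix_vector_mul_bounded_linear)
  obtain \<alpha> where "0 < \<alpha>" and gain: "(\<epsilon> * (L + 2 * \<alpha> * k))\<^sup>2 < 4 * \<epsilon> * \<alpha>"
    using small_gain_weight_exists[OF eps_pos l_pos \<open>0 \<le> k\<close> eps_small[folded k_def]] .
  obtain \<delta> where "0 < \<delta>"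
    and margin: "\<And>a c. \<epsilon> * (L + 2 * \<alpha> * k) * a * c \<le> (\<epsilon> - \<delta>) * a\<^sup>2 + (\<alpha> - \<delta>) * c\<^sup>2"
    using quadratic_form_margin[OF eps_pos \<open>0 < \<alpha>\<close> gain] by metis
  have "lyapunov_deriv \<alpha> t \<le> - \<delta> * (norm (feedback t, steady_state_error t))\<^sup>2" for t
    using lyapunov_deriv_le[OF less_imp_le[OF \<open>0 < \<alpha>\<close>], of t, folded k_def]
      margin[of "norm (feedback t)" "norm (steady_state_error t)"]
    by (simp add: norm_Pair algebra_simps)
  then show ?thesis by (intro that[OF \<open>0 < \<alpha>\<close> \<open>0 < \<delta>\<close>])
qed

lemma reduced_cost_le_lyapunov: "0 \<le> \<alpha> \<Longrightarrow> reduced_cost (u t) \<le> lyapunov \<alpha> t"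
  unfolding lyapunov_def using quadratic_form_P_nonneg by simp

lemma trajectory_in_sublevel:
  assumes "0 \<le> \<alpha>" and decr: "\<And>t. 0 \<le> t \<Longrightarrow> lyapunov_deriv \<alpha> t \<le> 0" and "0 \<le> t"
  shows "reduced_cost (u t) \<le> lyapunov \<alpha> 0"
  using reduced_cost_le_lyapunov[OF assms(1)]
    DERIV_nonpos_imp_decreasing_on_nonneg[OF lyapunov_has_derivative decr order_refl \<open>0 \<le> t\<close>]
  by (rule order_trans)

lemma lyapunov_gap:
  assumes "0 \<le> \<alpha>" and decr: "\<And>t. 0 \<le> t \<Longrightarrow> lyapunov_deriv \<alpha> t \<le> 0" and "v0 \<in> minimisers"
  obtains C where "\<And>t. 0 \<le> t \<Longrightarrow> lyapunov \<alpha> t - reduced_cost v0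
     \<le> C * (norm (feedback t, steady_state_error t) + (norm (feedback t, steady_state_error t))\<^sup>2)"
proof -
  obtain b where b: "\<And>v. reduced_cost v \<le> lyapunov \<alpha> 0 \<Longrightarrow> norm v \<le> b"
    using compact_imp_bounded[OF compact_reduced_cost_sublevel] by (auto simp: bounded_iff)
  define D where "D = b + norm v0"
  have D: "norm (u t - v0) \<le> D" if "0 \<le> t" for t
    using b[OF trajectory_in_sublevel[OF assms(1) decr that]] norm_triangle_ineq4[of "u t" v0]
    by (simp add: D_def)
  have "0 \<le> D" using D[of 0] norm_ge_zero[of "u 0 - v0"] by linarith
  define normP where "normP = onorm ((*v) P)"
  have "0 \<le> normP" unfolding normP_def by (intro onorm_pos_le matrix_vector_mul_bounded_linear)
  show ?thesis
  proof (rule that[of "(1 + L) * D + \<alpha> * normP"])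
    fix t :: real assume "0 \<le> t"
    define z where "z = steady_state_error t"
    define s where "s = norm (feedback t, z)"
    have "norm (feedback t) \<le> s" "norm z \<le> s"
      unfolding s_def by (rule norm_fst_le, rule norm_snd_le)
    moreover have "L * norm z \<le> L * s" using \<open>norm z \<le> s\<close> l_pos by (intro mult_left_mono) auto
    ultimately have "norm (feedback t) + L * norm z \<le> (1 + L) * s"
      by (simp only: distrib_right mult_1_left)
    then have "(norm (feedback t) + L * norm z) * norm (u t - v0) \<le> ((1 + L) * s) * D"
      using D[OF \<open>0 \<le> t\<close>] l_pos by (intro mult_mono) (auto simp: s_def)
    then have "reduced_cost (u t) - reduced_cost v0 \<le> ((1 + L) * s) * D"
      using reduced_cost_gap[OF \<open>v0 \<in> minimisers\<close>, of t] by (simp add: z_def)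
    moreover have "\<alpha> * (z \<bullet> (P *v z)) \<le> \<alpha> * (normP * s\<^sup>2)"
    proof (rule mult_left_mono[OF _ assms(1)])
      have "(norm z)\<^sup>2 \<le> s\<^sup>2" using \<open>norm z \<le> s\<close> by (intro power_mono) auto
      then show "z \<bullet> (P *v z) \<le> normP * s\<^sup>2"
        using quadratic_form_le_onorm[of z P] mult_left_mono[OF _ \<open>0 \<le> normP\<close>]
        unfolding normP_def by (meson order_trans)
    qed
    moreover have "0 \<le> (1 + L) * D * s\<^sup>2 + \<alpha> * normP * s"
      using l_pos \<open>0 \<le> D\<close> \<open>0 \<le> normP\<close> assms(1) by (simp add: s_def)
    ultimately show "lyapunov \<alpha> t - reduced_cost v0 \<le> ((1 + L) * D + \<alpha> * normP) * (s + s\<^sup>2)"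
      by (simp add: lyapunov_def z_def algebra_simps)
  qed
qed

lemma lyapunov_tendsto_min:
  assumes "v0 \<in> minimisers"
  obtains \<alpha> where "0 < \<alpha>" "\<And>t. lyapunov_deriv \<alpha> t \<le> 0" "(lyapunov \<alpha> \<longlongrightarrow> reduced_cost v0) at_top"
proof -
  obtain \<alpha> \<delta> where "0 < \<alpha>" "0 < \<delta>"
    and decay: "\<And>t. lyapunov_deriv \<alpha> t \<le> - \<delta> * (norm (feedback t, steady_state_error t))\<^sup>2"
    using lyapunov_decay by metis
  have decr: "lyapunov_deriv \<alpha> t \<le> 0" for t
    using decay[of t] \<open>0 < \<delta>\<close> by (simp add: mult_nonneg_nonneg order_trans)
  obtain C where gap: "\<And>t. 0 \<le> t \<Longrightarrow> lyapunov \<alpha> t - reduced_cost v0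
     \<le> C * (norm (feedback t, steady_state_error t) + (norm (feedback t, steady_state_error t))\<^sup>2)"
    using lyapunov_gap[OF less_imp_le[OF \<open>0 < \<alpha>\<close>] decr assms] by metis
  have lower: "reduced_cost v0 \<le> lyapunov \<alpha> t" for t
    using assms reduced_cost_le_lyapunov[OF less_imp_le[OF \<open>0 < \<alpha>\<close>]] order_trans
    by (fastforce simp: minimisers_def)
  have "(lyapunov \<alpha> \<longlongrightarrow> reduced_cost v0) at_top"
    by (rule lyapunov_decay_tendsto[OF lyapunov_has_derivative decay \<open>0 < \<delta>\<close> lower gap]) simp_all
  with \<open>0 < \<alpha>\<close> decr show ?thesis by (rule that)
qed

lemma lyapunov_tendsto_imp_cost_and_error_tendsto:
  assumes "0 < \<alpha>" "v0 \<in> minimisers" and lim: "(lyapunov \<alpha> \<longlongrightarrow> reduced_cost v0) at_top"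
  shows "((\<lambda>t. reduced_cost (u t)) \<longlongrightarrow> reduced_cost v0) at_top"
    and "(steady_state_error \<longlongrightarrow> 0) at_top"
proof -
  have min: "reduced_cost v0 \<le> reduced_cost (u t)" for t
    using \<open>v0 \<in> minimisers\<close> by (simp add: minimisers_def)
  show "((\<lambda>t. reduced_cost (u t)) \<longlongrightarrow> reduced_cost v0) at_top"
    by (rule tendsto_sandwich[OF _ _ tendsto_const lim])
      (simp_all add: min reduced_cost_le_lyapunov less_imp_le[OF \<open>0 < \<alpha>\<close>])
  obtain \<mu> where "0 < \<mu>" and \<mu>: "\<And>v. \<mu> * (norm v)\<^sup>2 \<le> v \<bullet> (P *v v)"
    using quadratic_form_pos_def_lower_bound[OF P_pd] by metis
  have bound: "(norm (steady_state_error t))\<^sup>2 \<le> (lyapunov \<alpha> t - reduced_cost v0) / (\<alpha> * \<mu>)" for t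
  proof -
    define z where "z = steady_state_error t"
    have "(norm z)\<^sup>2 * (\<alpha> * \<mu>) \<le> \<alpha> * (z \<bullet> (P *v z))"
      using \<mu>[of z] \<open>0 < \<alpha>\<close> by (simp add: algebra_simps)
    then have "(norm z)\<^sup>2 * (\<alpha> * \<mu>) \<le> lyapunov \<alpha> t - reduced_cost v0"
      unfolding lyapunov_def z_def using min[of t] by linarith
    then show ?thesis using \<open>0 < \<alpha>\<close> \<open>0 < \<mu>\<close> by (simp add: z_def pos_le_divide_eq)
  qed
  have lim_bound: "((\<lambda>t. (lyapunov \<alpha> t - reduced_cost v0) / (\<alpha> * \<mu>)) \<longlongrightarrow> 0) at_top"
    using tendsto_divide[OF tendsto_diff[OF lim tendsto_const[of "reduced_cost v0"]] tendsto_const[of "\<alpha> * \<mu>"]]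
      \<open>0 < \<alpha>\<close> \<open>0 < \<mu>\<close> by simp
  then have "((\<lambda>t. (norm (steady_state_error t))\<^sup>2) \<longlongrightarrow> 0) at_top"
    by (intro tendsto_sandwich[OF _ _ tendsto_const lim_bound]) (simp_all add: bound)
  from tendsto_real_sqrt[OF this] show "(steady_state_error \<longlongrightarrow> 0) at_top"
    by (simp add: tendsto_norm_zero_iff)
qed

lemma infdist_minimisers_tendsto:
  assumes "0 \<le> \<alpha>" and decr: "\<And>t. 0 \<le> t \<Longrightarrow> lyapunov_deriv \<alpha> t \<le> 0" and "v0 \<in> minimisers"
    and cost: "((\<lambda>t. reduced_cost (u t)) \<longlongrightarrow> reduced_cost v0) at_top"
  shows "((\<lambda>t. infdist (u t) minimisers) \<longlongrightarrow> 0) at_top"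
proof (rule tendsto_infdist_argmin[OF compact_reduced_cost_sublevel
      continuous_on_subset[OF continuous_on_reduced_cost subset_UNIV] _ cost])
  show "\<forall>\<^sub>F t in at_top. u t \<in> {v. reduced_cost v \<le> lyapunov \<alpha> 0}"
    using eventually_ge_at_top[of 0]
    by eventually_elim (simp add: trajectory_in_sublevel[OF assms(1) decr])
qed (use \<open>v0 \<in> minimisers\<close> in \<open>auto simp: minimisers_def\<close>)

end

theorem corollary1:
  fixes A :: "real^'n^'n" and B :: "real^'p^'n" and Q :: "real^'q^'n"
    and P :: "real^'n^'n"
    and \<Phi> :: "real^'n \<Rightarrow> real^'p \<Rightarrow> real"
    and gx :: "real^'n \<Rightarrow> real^'p \<Rightarrow> real^'n"
    and gu :: "real^'n \<Rightarrow> real^'p \<Rightarrow> real^'p"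
    and w :: "real^'q" and \<epsilon> :: real and L :: real
    and x :: "real \<Rightarrow> real^'n" and u :: "real \<Rightarrow> real^'p"
  assumes grad: "\<And>x0 u0. ((\<lambda>(x, u). \<Phi> x u) has_derivative
                   (\<lambda>(dx, du). gx x0 u0 \<bullet> dx + gu x0 u0 \<bullet> du)) (at (x0, u0))"
    and eps_pos: "\<epsilon> > 0"
    and P_sym: "transpose P = P"
    and P_pd: "\<And>v. v \<noteq> 0 \<Longrightarrow> v \<bullet> (P *v v) > 0"
    and lyap: "\<And>v. v \<bullet> ((transpose A ** P + P ** A) *v v) \<le> - (v \<bullet> v)"
    and diff_tilde: "\<And>w' u0. (\<lambda>u. \<Phi> (Hmat A B *v u + Rmat A Q *v w') u) differentiable (at u0)"
    and l_pos: "L > 0"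
    and lip: "\<And>x1 x2 u0. norm (HtildeT (Hmat A B) (gx x1 u0) (gu x1 u0)
                               - HtildeT (Hmat A B) (gx x2 u0) (gu x2 u0)) \<le> L * norm (x1 - x2)"
    and sublevel: "\<And>c. compact {u. \<Phi> (Hmat A B *v u + Rmat A Q *v w) u \<le> c}"
    and cvx: "convex_on UNIV (\<lambda>(x, u). \<Phi> x u)"
    and eps_small: "2 * \<epsilon> * L * onorm (\<lambda>v. (P ** Hmat A B) *v v) < 1"
    and x_ode: "\<And>t. t \<ge> 0 \<Longrightarrow> (x has_vector_derivative (A *v x t + B *v u t + Q *v w)) (at t within {0..})"
    and u_ode: "\<And>t. t \<ge> 0 \<Longrightarrow> (u has_vector_derivative
                 (- \<epsilon> *\<^sub>R HtildeT (Hmat A B) (gx (x t) (u t)) (gu (x t) (u t)))) (at t within {0..})"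
  shows "global_solutions \<Phi> (Hmat A B) (Rmat A Q) w \<noteq> {} \<and>
         ((\<lambda>t. infdist (x t, u t) (global_solutions \<Phi> (Hmat A B) (Rmat A Q) w)) \<longlongrightarrow> 0) at_top"
proof -
  interpret closed_loop A B Q P \<Phi> gx gu w \<epsilon> L x u
    by unfold_locales (fact assms)+
  obtain v0 where v0: "v0 \<in> minimisers" by (rule reduced_cost_attains_min)
  obtain \<alpha> where "0 < \<alpha>" and decr: "\<And>t. lyapunov_deriv \<alpha> t \<le> 0"
    and lim: "(lyapunov \<alpha> \<longlongrightarrow> reduced_cost v0) at_top"
    using lyapunov_tendsto_min[OF v0] by metis
  note cost = lyapunov_tendsto_imp_cost_and_error_tendsto(1)[OF \<open>0 < \<alpha>\<close> v0 lim]
    and err = lyapunov_tendsto_imp_cost_and_error_tendsto(2)[OF \<open>0 < \<alpha>\<close> v0 lim]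
  have bound_lim: "((\<lambda>t. norm (steady_state_error t) + (onorm ((*v) H) + 1) * infdist (u t) minimisers)
      \<longlongrightarrow> 0) at_top"
    using infdist_minimisers_tendsto[OF less_imp_le[OF \<open>0 < \<alpha>\<close>] decr v0 cost]
    by (intro tendsto_add_zero tendsto_mult_right_zero) (simp_all add: err tendsto_norm_zero_iff)
  have "((\<lambda>t. infdist (x t, u t) (global_solutions \<Phi> H R w)) \<longlongrightarrow> 0) at_top"
    by (rule tendsto_sandwich[OF _ _ tendsto_const bound_lim])
      (simp_all add: infdist_nonneg infdist_global_solutions_le)
  moreover have "global_solutions \<Phi> H R w \<noteq> {}"
    using v0 by (auto simp: global_solutions_eq_minimisers)
  ultimately show ?thesis by simp
qed

end
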